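(* Let $\widehat E=E+\varepsilon E_0$ and $\widehat F=F+\varepsilon F_0$ be elements of $\mathbb{D}_n^{\rm CM}$. Then $\widehat E\overset{{\rm DM}\text{-}\#}{\leq}\widehat F$ (Dual-minus sharp partial order) if and only if $\widehat E\overset{\rm D}{\leq}\widehat F$ (Dual-minus partial order) and $EF=FE$.
   Context: $\varepsilon$ is the dual unit: $\varepsilon\neq 0$, $\varepsilon^2=0$, commuting with reals. $\mathbb{D}^{m\times n}$ is the set of $m\times n$ dual matrices $\widehat E=E+\varepsilon E_0$ with $E,E_0\in\mathbb{R}^{m\times n}$, with the obvious addition, multiplication and transpose $\widehat E^{T}=E^T+\varepsilon E_0^T$. The dual Moore-Penrose generalized inverse (DMPGI) of $\widehat E\in\mathbb{D}^{m\times n}$ is the unique $\widehat X\in\mathbb{D}^{n\times m}$, if it exists, with $\widehat E\widehat X\widehat E=\widehat E$, $\widehat X\widehat E\widehat X=\widehat X$, $(\widehat E\widehat X)^T=\widehat E\widehat X$, $(\widehat X\widehat E)^T=\widehat X\widehat E$. The dual group generalized inverse (DGGI) of $\widehat E\in\mathbb{D}^{n\times n}$ is the $\widehat X\in\mathbb{D}^{n\times n}$, if it exists, with $\widehat E\widehat X\widehat E=\widehat E$, $\widehat X\widehat E\widehat X=\widehat X$, $\widehat E\widehat X=\widehat X\widehat E$. $\mathbb{D}_n^{\rm CM}$ is the set of dual matrices in $\mathbb{D}^{n\times n}$ of dual index one, i.e. (equivalently) those whose DGGI exists; for $\widehat E=E+\varepsilon E_0\in\mathbb{D}_n^{\rm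 CM}$ the DMPGI of $\widehat E$ exists and $\mathrm{rk}(E^2)=\mathrm{rk}(E)$. Minus partial order on real matrices of the same size: $E\leq F$ means $\mathrm{rk}(F-E)=\mathrm{rk}(F)-\mathrm{rk}(E)$. Sharp partial order: for real $n\times n$ matrices $E,F$ with $\mathrm{rk}(E^2)=\mathrm{rk}(E)$ and $\mathrm{rk}(F^2)=\mathrm{rk}(F)$, $E\overset{\#}{\leq}F$ means $EF=E^2=FE$. Dual-minus partial order: for dual matrices $\widehat E,\widehat F$ of the same size whose DMPGIs exist, $\widehat E\overset{\rm D}{\leq}\widehat F$ means that $E\leq F$ and the DMPGI of $\widehat F-\widehat E$ exists. Dual-minus sharp partial order: for $\widehat E,\widehat F\in\mathbb{D}_n^{\rm CM}$, $\widehat E\overset{{\rm DM}\text{-}\#}{\leq}\widehat F$ means that $E\overset{\#}{\leq}F$ and the DMPGI of $\widehat F-\widehat E$ exists. *)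

theory Defs
  imports "HOL-Analysis.Analysis"
begin

datatype dual_number = Dual (std: real) (eps: real)

text \<open>\<open>Dual a b\<close> is the dual number \<open>a + \<epsilon> b\<close>; see \<open>dual_number_eq\<close> below.\<close>

instantiation dual_number :: comm_ring_1
begin

definition zero_dual_number :: dual_number where "0 = Dual 0 0"
definition one_dual_number :: dual_number where "1 = Dual 1 0"
definition uminus_dual_number :: "dual_number \<Rightarrow> dual_number"
  where "- x = Dual (- std x) (- eps x)"
definition plus_dual_number :: "dual_number \<Rightarrow> dual_number \<Rightarrow> dual_number"
  where "x + y = Dual (std x + std y) (eps x + eps y)"
definition minus_dual_number :: "dual_number \<Rightarrow> dual_number \<Rightarrow> dual_number"
  where "x - y = Dual (std x - std y) (eps x - eps y)"
definition times_dual_number :: "dual_number \<Rightarrow> dual_number \<Rightarrow> dual_number"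
  where "x * y = Dual (std x * std y) (std x * eps y + eps x * std y)"

instance
  by standard
    (simp_all add: zero_dual_number_def one_dual_number_def uminus_dual_number_def
      plus_dual_number_def minus_dual_number_def times_dual_number_def algebra_simps)

end

lemma std_simps [simp]:
  "std 0 = 0" "std 1 = 1" "std (- x) = - std x"
  "std (x + y) = std x + std y" "std (x - y) = std x - std y" "std (x * y) = std x * std y"
  by (simp_all add: zero_dual_number_def one_dual_number_def uminus_dual_number_def
      plus_dual_number_def minus_dual_number_def times_dual_number_def)

lemma eps_simps [simp]:
  "eps 0 = 0" "eps 1 = 0" "eps (- x) = - eps x"
  "eps (x + y) = eps x + eps y" "eps (x - y) = eps x - eps y"
  "eps (x * y) = std x * eps y + eps x * std y"
  by (simp_all add: zero_dual_number_def one_dual_number_def uminus_dual_number_def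
      plus_dual_number_def minus_dual_number_def times_dual_number_def)

lemma std_sum [simp]: "std (sum f A) = (\<Sum>i\<in>A. std (f i))"
  by (induction A rule: infinite_finite_induct) simp_all

lemma eps_sum [simp]: "eps (sum f A) = (\<Sum>i\<in>A. eps (f i))"
  by (induction A rule: infinite_finite_induct) simp_all

definition dual_unit :: dual_number where "dual_unit = Dual 0 1"

lemma dual_unit_nonzero: "dual_unit \<noteq> 0"
  by (simp add: dual_unit_def zero_dual_number_def)

lemma dual_unit_square: "dual_unit ^ 2 = 0"
  by (simp add: dual_unit_def zero_dual_number_def power2_eq_square times_dual_number_def)

lemma dual_number_eq: "Dual a b = Dual a 0 + dual_unit * Dual b 0"
  by (simp add: dual_unit_def plus_dual_number_def times_dual_number_def)

text \<open>
  Dual matrices are matrices \<open>dual_number ^ 'n ^ 'm\<close>, with the library's addition,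
  multiplication \<open>**\<close> and \<open>transpose\<close>. Their standard and infinitesimal parts (\<open>std_mat\<close>, \<open>eps_mat\<close>) are the real
  matrices \<open>E\<close> and \<open>E\<^sub>0\<close> of \<open>E + \<epsilon> E\<^sub>0\<close>.
\<close>

definition std_mat :: "dual_number ^ 'n ^ 'm \<Rightarrow> real ^ 'n ^ 'm"
  where "std_mat A = (\<chi> i j. std (A $ i $ j))"

definition eps_mat :: "dual_number ^ 'n ^ 'm \<Rightarrow> real ^ 'n ^ 'm"
  where "eps_mat A = (\<chi> i j. eps (A $ i $ j))"

lemma dual_mat_eq_iff: "A = B \<longleftrightarrow> std_mat A = std_mat B \<and> eps_mat A = eps_mat B"
  by (auto simp: std_mat_def eps_mat_def vec_eq_iff intro: dual_number.expand)

lemma std_mat_simps [simp]: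
  "std_mat (A + B) = std_mat A + std_mat B"
  "std_mat (A - B) = std_mat A - std_mat B"
  "std_mat (C ** D) = std_mat C ** std_mat D"
  "std_mat (transpose A) = transpose (std_mat A)"
  by (simp_all add: std_mat_def matrix_matrix_mult_def transpose_def vec_eq_iff)

lemma eps_mat_simps [simp]:
  "eps_mat (A + B) = eps_mat A + eps_mat B"
  "eps_mat (A - B) = eps_mat A - eps_mat B"
  "eps_mat (C ** D) = std_mat C ** eps_mat D + eps_mat C ** std_mat D"
  "eps_mat (transpose A) = transpose (eps_mat A)"
  by (simp_all add: std_mat_def eps_mat_def matrix_matrix_mult_def transpose_def vec_eq_iff
      sum.distrib)

definition is_DMPGI :: "dual_number ^ 'n ^ 'm \<Rightarrow> dual_number ^ 'm ^ 'n \<Rightarrow> bool"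
  where "is_DMPGI A X \<longleftrightarrow>
    A ** X ** A = A \<and> X ** A ** X = X \<and>
    transpose (A ** X) = A ** X \<and> transpose (X ** A) = X ** A"

definition has_DMPGI :: "dual_number ^ 'n ^ 'm \<Rightarrow> bool"
  where "has_DMPGI A \<longleftrightarrow> (\<exists>X. is_DMPGI A X)"

lemma is_DMPGI_unique:
  assumes X: "is_DMPGI A X" and Y: "is_DMPGI A Y"
  shows "X = Y"
proof -
  note x = X[unfolded is_DMPGI_def] and y = Y[unfolded is_DMPGI_def]
  have "A ** X = transpose (A ** Y ** (A ** X))"
    using x y by (simp add: matrix_mul_assoc)
  also have "\<dots> = A ** X ** (A ** Y)"
    using x y by (simp only: matrix_transpose_mul)
  also have "\<dots> = A ** Y"
    using x by (simp add: matrix_mul_assoc)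
  finally have AX: "A ** X = A ** Y" .
  have "X ** A = transpose (X ** A ** (Y ** A))"
    using x y by (metis matrix_mul_assoc)
  also have "\<dots> = Y ** A ** (X ** A)"
    using x y by (simp only: matrix_transpose_mul)
  also have "\<dots> = Y ** A"
    using x by (metis matrix_mul_assoc)
  finally have XA: "X ** A = Y ** A" .
  have "X = X ** A ** X" using x by simp
  also have "\<dots> = Y ** (A ** X)" by (simp add: XA matrix_mul_assoc)
  also have "\<dots> = Y" using y by (simp add: AX matrix_mul_assoc)
  finally show ?thesis .
qed

definition is_DGGI :: "dual_number ^ 'n ^ 'n \<Rightarrow> dual_number ^ 'n ^ 'n \<Rightarrow> bool"
  where "is_DGGI A X \<longleftrightarrow>
    A ** X ** A = A \<and> X ** A ** X = X \<and> A ** X = X ** A"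

text \<open>Dual matrices of dual index one are taken as those possessing a dual group inverse.\<close>

definition dual_CM :: "(dual_number ^ 'n ^ 'n) set"
  where "dual_CM = {A. \<exists>X. is_DGGI A X}"

text \<open>
  The orders are defined only on certain classes of matrices; membership of both arguments in
  the class is made part of the relation. Ranks are subtracted in the integers, since
  subtraction on \<open>nat\<close> truncates.
\<close>

definition minus_le :: "real ^ 'n ^ 'm \<Rightarrow> real ^ 'n ^ 'm \<Rightarrow> bool"
  where "minus_le E F \<longleftrightarrow> int (rank (F - E)) = int (rank F) - int (rank E)"

definition sharp_le :: "real ^ 'n ^ 'n \<Rightarrow> real ^ 'n ^ 'n \<Rightarrow> bool"
  where "sharp_le E F \<longleftrightarrow>
    rank (E ** E) = rank E \<and> rank (F ** F) = rank F \<and>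
    E ** F = E ** E \<and> E ** E = F ** E"

definition dual_minus_le :: "dual_number ^ 'n ^ 'm \<Rightarrow> dual_number ^ 'n ^ 'm \<Rightarrow> bool"
  where "dual_minus_le A B \<longleftrightarrow>
    has_DMPGI A \<and> has_DMPGI B \<and> minus_le (std_mat A) (std_mat B) \<and> has_DMPGI (B - A)"

definition dual_minus_sharp_le :: "dual_number ^ 'n ^ 'n \<Rightarrow> dual_number ^ 'n ^ 'n \<Rightarrow> bool"
  where "dual_minus_sharp_le A B \<longleftrightarrow>
    A \<in> dual_CM \<and> B \<in> dual_CM \<and> sharp_le (std_mat A) (std_mat B) \<and> has_DMPGI (B - A)"

end

theory Submission
  imports Defs
begin

text \<open>
  Regularity of a dual matrix (existence of any inner inverse) already gives a DMPGI: an idempotent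
  \<open>P\<close> over the dual numbers can be replaced by Kaplansky's orthogonal projector
  \<open>P P\<^sup>T U\<close> with \<open>U\<close> the inverse of \<open>1 + (P - P\<^sup>T) (P\<^sup>T - P)\<close>, which exists because the standard part of
  that matrix is positive definite. Hence dual index one implies that the DMPGI exists, and only real
  matrices remain to be compared. There, additivity of rank means that the column spaces of
  \<open>E\<close> and \<open>F - E\<close> are independent with sum the column space of \<open>F\<close>, so that
  \<open>E = E Y E = F Y E\<close> for every inner inverse \<open>Y\<close> of \<open>F\<close>; if \<open>E\<close> and \<open>F\<close> commute, then
  \<open>F E = F E Y E = E F Y E = E\<^sup>2\<close>.
\<close>

section \<open>Dual matrices\<close>

lemma matrix_add_rdistrib: "(A + B) ** C = A ** C + B ** (C :: 'a::semiring_1 ^ _ ^ _)"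
  by (vector matrix_matrix_mult_def sum.distrib[symmetric] algebra_simps)

lemma matrix_diff_ldistrib: "A ** (B - C) = A ** B - A ** (C :: 'a::ring_1 ^ _ ^ _)"
  by (vector matrix_matrix_mult_def sum_subtractf[symmetric] algebra_simps)

lemma matrix_diff_rdistrib: "(A - B) ** C = A ** C - B ** (C :: 'a::ring_1 ^ _ ^ _)"
  by (vector matrix_matrix_mult_def sum_subtractf[symmetric] algebra_simps)

lemma transpose_add: "transpose (A + B) = transpose A + transpose B"
  by (vector transpose_def)

lemma transpose_diff: "transpose (A - B) = transpose A - transpose B"
  by (vector transpose_def)

lemmas matrix_ring_simps =
  matrix_add_ldistrib matrix_add_rdistrib matrix_diff_ldistrib matrix_diff_rdistrib
  matrix_mul_assoc

lemma std_mat_mat_1 [simp]: "std_mat (mat 1) = mat 1"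
  by (simp add: std_mat_def mat_def vec_eq_iff)

lemma eps_mat_mat_1 [simp]: "eps_mat (mat 1) = 0"
  by (simp add: eps_mat_def mat_def vec_eq_iff)

lemma dual_mat_exhaust:
  obtains A :: "dual_number ^ 'n ^ 'm" where "std_mat A = M" and "eps_mat A = N"
proof
  show "std_mat (\<chi> i j. Dual (M $ i $ j) (N $ i $ j)) = M"
    by (simp add: std_mat_def vec_eq_iff)
  show "eps_mat (\<chi> i j. Dual (M $ i $ j) (N $ i $ j)) = N"
    by (simp add: eps_mat_def vec_eq_iff)
qed

text \<open>The infinitesimal part is nilpotent and cannot obstruct inversion: with \<open>V\<close>
  inverse to the standard part, the first-order expansion gives the inverse with infinitesimal part
  \<open>- V ** eps_mat A ** V\<close>.\<close>

lemma invertible_dual_mat: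
  fixes A :: "dual_number ^ 'n ^ 'n"
  assumes "invertible (std_mat A)"
  shows "invertible A"
proof -
  obtain V where V: "std_mat A ** V = mat 1" "V ** std_mat A = mat 1"
    using assms by (auto simp: invertible_def)
  obtain W where W: "std_mat W = V" "eps_mat W = 0 - V ** eps_mat A ** V"
    by (rule dual_mat_exhaust)
  have "std_mat A ** (V ** eps_mat A ** V) = eps_mat A ** V"
    by (simp add: matrix_mul_assoc V)
  moreover have "V ** eps_mat A ** V ** std_mat A = V ** eps_mat A"
    by (simp add: matrix_mul_assoc[symmetric] V)
  ultimately have "A ** W = mat 1" "W ** A = mat 1"
    by (simp_all only: dual_mat_eq_iff W V std_mat_simps eps_mat_simps std_mat_mat_1 eps_mat_mat_1
        matrix_diff_ldistrib matrix_diff_rdistrib) simp_all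
  then show ?thesis
    by (auto simp: invertible_def)
qed

text \<open>Pairing the image of \<open>x\<close> with \<open>x\<close> gives the sum of the squared
  norms of \<open>x\<close> and \<open>transpose N *v x\<close>, so the kernel is trivial.\<close>

lemma invertible_1_plus_mult_transpose:
  fixes N :: "real ^ 'm ^ 'n"
  shows "invertible (mat 1 + N ** transpose N)"
proof -
  have "x = 0" if x: "(mat 1 + N ** transpose N) *v x = 0" for x
  proof -
    have "x \<bullet> (N *v (transpose N *v x)) = (transpose N *v x) \<bullet> (transpose N *v x)"
      by (metis dot_lmul_matrix transpose_matrix_vector)
    moreover have "x \<bullet> x + x \<bullet> (N *v (transpose N *v x)) = 0"
      using arg_cong[OF x, of "\<lambda>y. x \<bullet> y"]
      by (simp add: matrix_vector_mult_add_rdistrib matrix_vector_mul_assoc inner_add_right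
          del: transpose_matrix_vector)
    ultimately show "x = 0"
      by (metis add_nonneg_eq_0_iff inner_eq_zero_iff inner_ge_zero)
  qed
  then show ?thesis
    by (auto simp: invertible_left_inverse matrix_left_invertible_ker)
qed

text \<open>The last two equations say that \<open>Q\<close> and \<open>P\<close> have the same
  column space.\<close>

lemma orthogonal_projector_exists:
  fixes P :: "dual_number ^ 'n ^ 'n"
  assumes P: "P ** P = P"
  obtains Q where "transpose Q = Q" "P ** Q = Q" "Q ** P = P"
proof -
  let ?T = "transpose P"
  define U where "U = mat 1 + (P - ?T) ** transpose (P - ?T)"
  have "invertible U"
    by (rule invertible_dual_mat) (simp add: U_def invertible_1_plus_mult_transpose)
  then obtain V where UV: "U ** V = mat 1" and VU: "V ** U = mat 1"
    by (auto simp: invertible_def)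
  have T: "?T ** ?T = ?T"
    using P by (metis matrix_transpose_mul)
  have U: "U = mat 1 + P ** ?T - P - ?T + ?T ** P"
    by (simp add: U_def transpose_diff matrix_ring_simps P T)
  \<comment> \<open>Idempotence collapses both products to the same matrix, so \<open>P\<close>
    commutes with \<open>U\<close>; symmetry of \<open>U\<close> transfers this to
    \<open>?T\<close>.\<close>
  have PU: "P ** U = P ** ?T ** P"
    by (simp add: U matrix_ring_simps P)
  have UP: "U ** P = P ** ?T ** P"
    by (simp add: U matrix_ring_simps) (simp add: matrix_mul_assoc[symmetric] P)
  have "transpose U = U"
    by (simp add: U_def transpose_add matrix_transpose_mul)
  then have TU: "?T ** U = U ** ?T"
    using PU UP by (metis matrix_transpose_mul)
  have commV: "X ** V = V ** X" if "X ** U = U ** X" for X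
    by (metis that UV VU matrix_mul_assoc matrix_mul_lid matrix_mul_rid)
  have PV: "P ** V = V ** P" and TV: "?T ** V = V ** ?T"
    using PU UP TU by (simp_all add: commV)
  have "transpose V ** U = mat 1"
    using arg_cong[OF UV, of transpose] \<open>transpose U = U\<close> by (simp add: matrix_transpose_mul)
  then have "transpose V ** U ** V = V"
    by simp
  then have tV: "transpose V = V"
    by (simp add: matrix_mul_assoc[symmetric] UV)
  show thesis
  proof
    show "transpose (P ** ?T ** V) = P ** ?T ** V"
      using PV TV by (simp add: matrix_transpose_mul tV) (metis matrix_mul_assoc)
    show "P ** (P ** ?T ** V) = P ** ?T ** V"
      by (simp add: matrix_mul_assoc P)
    have "P ** ?T ** V ** P = P ** ?T ** P ** V"
      by (metis PV matrix_mul_assoc)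
    also have "\<dots> = P"
      by (metis PU UV matrix_mul_assoc matrix_mul_rid)
    finally show "P ** ?T ** V ** P = P" .
  qed
qed

text \<open>The idempotent \<open>A ** X\<close> has the column space of \<open>A\<close>; its
  orthogonal replacement \<open>Q\<close> equals \<open>A ** (X ** Q)\<close> and still fixes
  \<open>A\<close>.\<close>

lemma symmetric_inner_inverse_exists:
  fixes A :: "dual_number ^ 'n ^ 'm"
  assumes "A ** X ** A = A"
  obtains Z where "A ** Z ** A = A" "transpose (A ** Z) = A ** Z"
proof -
  have "A ** X ** (A ** X) = A ** X"
    by (simp add: matrix_mul_assoc assms)
  then obtain Q where Q: "transpose Q = Q" "A ** X ** Q = Q" "Q ** (A ** X) = A ** X"
    by (rule orthogonal_projector_exists)
  show thesis
  proof
    show "A ** (X ** Q) ** A = A"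
      using Q assms by (metis matrix_mul_assoc)
    show "transpose (A ** (X ** Q)) = A ** (X ** Q)"
      using Q by (simp add: matrix_mul_assoc)
  qed
qed

text \<open>Applying the previous lemma to \<open>A\<close> and to its transpose yields
  \<open>Z\<close> and \<open>W\<close> with \<open>A ** Z\<close> and \<open>W ** A\<close>
  symmetric. The product \<open>W ** A ** Z\<close> inherits both symmetries.\<close>

lemma has_DMPGI_if_inner_inverse:
  fixes A :: "dual_number ^ 'n ^ 'm"
  assumes "A ** X ** A = A"
  shows "has_DMPGI A"
proof -
  obtain Z where Z: "A ** Z ** A = A" "transpose (A ** Z) = A ** Z"
    using assms by (rule symmetric_inner_inverse_exists)
  have "transpose A ** transpose X ** transpose A = transpose A"
    using assms by (metis matrix_mul_assoc matrix_transpose_mul)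
  then obtain Y where Y: "transpose A ** Y ** transpose A = transpose A"
      "transpose (transpose A ** Y) = transpose A ** Y"
    by (rule symmetric_inner_inverse_exists)
  define W where "W = transpose Y"
  have W: "A ** W ** A = A" "transpose (W ** A) = W ** A"
    using Y unfolding W_def by (metis matrix_mul_assoc matrix_transpose_mul transpose_transpose)+
  have "A ** (W ** A ** Z) = A ** Z" "W ** A ** Z ** A = W ** A"
    using W Z by (metis matrix_mul_assoc)+
  then have "is_DMPGI A (W ** A ** Z)"
    unfolding is_DMPGI_def using W Z by (metis matrix_mul_assoc)
  then show ?thesis
    by (auto simp: has_DMPGI_def)
qed

lemma dual_CM_has_DMPGI: "A \<in> dual_CM \<Longrightarrow> has_DMPGI A"
  by (auto simp: dual_CM_def is_DGGI_def intro: has_DMPGI_if_inner_inverse)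

lemma dual_CM_std_group_inverse:
  assumes "A \<in> dual_CM"
  obtains X where "std_mat A ** X ** std_mat A = std_mat A" "std_mat A ** X = X ** std_mat A"
proof -
  obtain X where "A ** X ** A = A" "A ** X = X ** A"
    using assms by (auto simp: dual_CM_def is_DGGI_def)
  then show thesis
    using that[of "std_mat X"] by (metis std_mat_simps(3))
qed

section \<open>Rank additivity\<close>

lemma range_matrix_mult_subset: "range ((*v) (A ** B)) \<subseteq> range ((*v) A)"
  by (auto simp: matrix_vector_mul_assoc[symmetric])

lemma rank_square_eq:
  fixes E X :: "real ^ 'n ^ 'n"
  assumes "E ** X ** E = E" "E ** X = X ** E"
  shows "rank (E ** E) = rank E"
proof (rule antisym)
  show "rank (E ** E) \<le> rank E"
    by (rule rank_mul_le_left)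
  have "X ** (E ** E) = E"
    using assms by (simp add: matrix_mul_assoc)
  then show "rank E \<le> rank (E ** E)"
    using rank_mul_le_right[of X "E ** E"] by simp
qed

text \<open>The column space of \<open>A + B\<close> lies in the sum \<open>?s\<close> of the two
  column spaces, and the dimension formula bounds \<open>dim ?s\<close> by
  \<open>rank A + rank B\<close>; additivity forces equality in both places.\<close>

lemma rank_add_eq_iff:
  fixes A B :: "real ^ 'n ^ 'm"
  shows "rank (A + B) = rank A + rank B \<longleftrightarrow>
    range ((*v) A) \<inter> range ((*v) B) = {0} \<and>
    range ((*v) A) \<subseteq> range ((*v) (A + B)) \<and> range ((*v) B) \<subseteq> range ((*v) (A + B))"
proof -
  let ?a = "range ((*v) A)" and ?b = "range ((*v) B)" and ?c = "range ((*v) (A + B))"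
  let ?s = "{x + y |x y. x \<in> ?a \<and> y \<in> ?b}"
  have sub: "subspace (range ((*v) M))" for M :: "real ^ 'n ^ 'm"
    by (intro linear_subspace_image matrix_vector_mul_linear subspace_UNIV)
  have subs: "subspace ?s"
    by (intro subspace_sums sub)
  have dims: "dim ?s + dim (?a \<inter> ?b) = rank A + rank B"
    unfolding rank_dim_range by (intro dim_sums_Int sub)
  have cs: "?c \<subseteq> ?s"
    by (auto simp: matrix_vector_mult_add_rdistrib)
  have zero: "0 \<in> ?a" "0 \<in> ?b"
    by (intro subspace_0 sub)+
  then have int: "dim (?a \<inter> ?b) = 0 \<longleftrightarrow> ?a \<inter> ?b = {0}"
    by (auto simp: dim_eq_0)
  have le: "rank (A + B) \<le> dim ?s"
    unfolding rank_dim_range by (rule dim_subset[OF cs])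
  have as: "?a \<subseteq> ?s" "?b \<subseteq> ?s"
    by (force intro: zero)+
  show ?thesis
  proof
    assume "rank (A + B) = rank A + rank B"
    then have "dim (?a \<inter> ?b) = 0" "dim ?s = dim ?c"
      using dims le unfolding rank_dim_range by linarith+
    moreover from this have "?c = ?s"
      by (intro subspace_dim_equal sub subs cs) simp
    ultimately show "?a \<inter> ?b = {0} \<and> ?a \<subseteq> ?c \<and> ?b \<subseteq> ?c"
      using int as by simp
  next
    assume r: "?a \<inter> ?b = {0} \<and> ?a \<subseteq> ?c \<and> ?b \<subseteq> ?c"
    then have "?s \<subseteq> ?c"
      using subspace_add[OF sub[of "A + B"]] by blast
    then have "?c = ?s"
      using cs by blast
    then show "rank (A + B) = rank A + rank B"
      using dims int r by (simp add: rank_dim_range)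
  qed
qed

text \<open>The sum stays unsimplified so that \<open>rank_add_eq_iff\<close> matches it.\<close>

lemma minus_le_iff_rank_add:
  "minus_le E F \<longleftrightarrow> rank (E + (F - E)) = rank E + rank (F - E)"
  by (auto simp: minus_le_def)

lemma minus_le_inner_inverse:
  fixes E F :: "real ^ 'n ^ 'm"
  assumes "minus_le E F" and Y: "F ** Y ** F = F"
  shows "F ** Y ** E = E" and "E ** Y ** E = E"
proof -
  have int: "range ((*v) E) \<inter> range ((*v) (F - E)) = {0}"
    and sub: "range ((*v) E) \<subseteq> range ((*v) F)"
    using assms(1) unfolding minus_le_iff_rank_add rank_add_eq_iff by simp_all
  have "(F ** Y ** E) *v x = E *v x" for x
  proof -
    obtain z where "E *v x = F *v z"
      using sub by blast
    then show ?thesis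
      by (metis Y matrix_vector_mul_assoc)
  qed
  then show FYE: "F ** Y ** E = E"
    by (simp add: matrix_eq)
  \<comment> \<open>The two factorizations below put this vector in the column spaces of both
    \<open>E\<close> and \<open>F - E\<close>, which meet only in 0.\<close>
  have "(E - E ** Y ** E) *v x = 0" for x
  proof -
    have "E - E ** Y ** E = E ** (mat 1 - Y ** E)" "E - E ** Y ** E = (F - E) ** (Y ** E)"
      by (simp_all add: matrix_ring_simps FYE)
    then have "(E - E ** Y ** E) *v x \<in> range ((*v) E) \<inter> range ((*v) (F - E))"
      by (metis IntI matrix_vector_mul_assoc rangeI)
    then show ?thesis
      using int by blast
  qed
  then have "E - E ** Y ** E = 0"
    by (simp add: matrix_eq)
  then show "E ** Y ** E = E"
    by simp
qed

lemma commuting_minus_le_imp_mult_eq_square: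
  fixes E F :: "real ^ 'n ^ 'n"
  assumes "minus_le E F" and "F ** Y ** F = F" and comm: "E ** F = F ** E"
  shows "E ** F = E ** E"
proof -
  note Y = minus_le_inner_inverse[OF assms(1,2)]
  have "E ** F = F ** E ** Y ** E"
    by (simp add: comm matrix_mul_assoc[symmetric]) (simp add: matrix_mul_assoc Y)
  also have "\<dots> = E ** (F ** Y ** E)"
    by (simp add: comm[symmetric] matrix_mul_assoc)
  finally show ?thesis
    by (simp add: Y)
qed

text \<open>The idempotent \<open>X ** E\<close> fixes the column space of \<open>E\<close> and
  annihilates that of \<open>F - E\<close>, so they are independent; both \<open>E\<close> and
  \<open>F - E\<close> are right multiples of \<open>F\<close>.\<close>

lemma sharp_le_imp_minus_le:
  fixes E F X :: "real ^ 'n ^ 'n"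
  assumes "E ** X ** E = E" "E ** X = X ** E" "E ** F = E ** E" "E ** E = F ** E"
  shows "minus_le E F"
proof -
  have E: "F ** (X ** E) = E"
    using assms by (metis matrix_mul_assoc)
  then have G: "F ** (mat 1 - X ** E) = F - E"
    by (simp add: matrix_diff_ldistrib)
  have XEG: "X ** E ** (F - E) = 0"
    using assms by (simp add: matrix_diff_ldistrib matrix_mul_assoc[symmetric])
  have "w = 0" if "w = E *v a" "w = (F - E) *v b" for w a b
  proof -
    have "X ** E *v w = w"
      using that(1) assms(1,2) by (simp add: matrix_vector_mul_assoc)
    moreover have "X ** E *v w = 0"
      using that(2) XEG by (simp add: matrix_vector_mul_assoc)
    ultimately show "w = 0"
      by simp
  qed
  moreover have "0 \<in> range ((*v) M)" for M :: "real ^ 'n ^ 'n"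
    by (metis matrix_vector_mult_0_right rangeI)
  ultimately have "range ((*v) E) \<inter> range ((*v) (F - E)) = {0}"
    by blast
  moreover have "range ((*v) E) \<subseteq> range ((*v) F)" "range ((*v) (F - E)) \<subseteq> range ((*v) F)"
    using range_matrix_mult_subset E G by metis+
  ultimately show ?thesis
    unfolding minus_le_iff_rank_add rank_add_eq_iff by simp
qed

theorem theorem4p4:
  fixes A B :: "dual_number ^ 'n ^ 'n"
  assumes "A \<in> dual_CM" and "B \<in> dual_CM"
  shows "dual_minus_sharp_le A B \<longleftrightarrow>
    dual_minus_le A B \<and> std_mat A ** std_mat B = std_mat B ** std_mat A"
proof -
  obtain X where X: "std_mat A ** X ** std_mat A = std_mat A" "std_mat A ** X = X ** std_mat A"
    using assms(1) by (rule dual_CM_std_group_inverse)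
  obtain Y where Y: "std_mat B ** Y ** std_mat B = std_mat B" "std_mat B ** Y = Y ** std_mat B"
    using assms(2) by (rule dual_CM_std_group_inverse)
  \<comment> \<open>Both dual orders share the condition on \<open>B - A\<close>, so only standard
    parts are compared; \<open>X\<close> and \<open>Y\<close> supply the rank conditions of
    \<open>sharp_le\<close>.\<close>
  have "sharp_le (std_mat A) (std_mat B) \<longleftrightarrow>
    minus_le (std_mat A) (std_mat B) \<and> std_mat A ** std_mat B = std_mat B ** std_mat A"
    using sharp_le_imp_minus_le[OF X] commuting_minus_le_imp_mult_eq_square[OF _ Y(1)]
      rank_square_eq[OF X] rank_square_eq[OF Y]
    unfolding sharp_le_def by metis
  then show ?thesis
    using assms
    by (auto simp: dual_minus_sharp_le_def dual_minus_le_def dual_CM_has_DMPGI)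
qed

end
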